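(* Let $H$ be a quasiconvex subgroup of a negatively curved group $G$. Then $\mathrm{WeakWidth}(H,G)$ is finite.
   Context: $G$ is finitely generated, with a fixed finite generating set $X^*=\{x,x^{-1}\mid x\in X\}$, and $\mathrm{Cayley}(G)$ is the corresponding Cayley graph with edges of length $1$. $G$ is negatively curved (Gromov hyperbolic) if for some $\delta\ge 0$, in every geodesic triangle in $\mathrm{Cayley}(G)$ each side is contained in the closed $\delta$-neighborhood of the union of the other two sides. A subgroup $H$ is quasiconvex if for some $K\ge 0$ every geodesic in $\mathrm{Cayley}(G)$ with both endpoints in $H$ is contained in the closed $K$-neighborhood of $H$. Elements $g_1,\dots,g_n$ of $G$ belong to different double cosets of $H$ if $Hg_iH\ne Hg_jH$ for $i\neq j$. The weak width of an infinite subgroup $H$ of $G$, denoted $\mathrm{WeakWidth}(H,G)$, is $n$ if there exists a collection of $n$ elements $\{g_1=1_G,g_2,\dots,g_n\}$ of $G$ belonging to different double cosets of $H$ such that $H\cap g_i^{-1}Hg_i$ is infinite for all $1\le i\le n$, and $n$ is the maximal possible (it is infinite if there is no maximal such $n$). The weak width of a finite subgroup is defined to be $0$. *)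

theory Defs
  imports Complex_Main "HOL-Library.Extended_Nat" "HOL-Algebra.Generated_Groups"
begin

definition sym_gens :: "('a, 'b) monoid_scheme \<Rightarrow> 'a set \<Rightarrow> 'a set" where
  "sym_gens G X = X \<union> (\<lambda>x. inv\<^bsub>G\<^esub> x) ` X"

text \<open>
  The Cayley graph is realized geometrically by barycentric coordinates: a point is a function on
  the vertices, the vertex \<open>g\<close> being the indicator function of \<open>{g}\<close>. The edges \<open>(g, x)\<close> and
  \<open>(gx, x\<inverse>)\<close> give the same segment, and a generator equal to the identity gives no
  segment other than the vertex itself (a loop would not affect distances between vertices).
\<close>

type_synonym 'a cpoint = "'a \<Rightarrow> real"

definition vertex :: "'a \<Rightarrow> 'a cpoint" where
  "vertex g = (\<lambda>w. of_bool (w = g))"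

definition edge_point :: "'a \<Rightarrow> 'a \<Rightarrow> real \<Rightarrow> 'a cpoint" where
  "edge_point g h t = (\<lambda>w. (1 - t) * vertex g w + t * vertex h w)"

definition cayley :: "('a, 'b) monoid_scheme \<Rightarrow> 'a set \<Rightarrow> 'a cpoint set" where
  "cayley G X = vertex ` carrier G \<union>
     {edge_point g (g \<otimes>\<^bsub>G\<^esub> x) t | g x t. g \<in> carrier G \<and> x \<in> sym_gens G X \<and> t \<in> {0..1}}"

text \<open>
  \<open>cayley_path G X p l q\<close>: there is a piecewise linear path of length \<open>l\<close> from \<open>p\<close> to \<open>q\<close>,
  each piece running inside one closed edge of length 1. The metric is the induced path metric.
\<close>

inductive cayley_path :: "('a, 'b) monoid_scheme \<Rightarrow> 'a set \<Rightarrow> 'a cpoint \<Rightarrow> real \<Rightarrow> 'a cpoint \<Rightarrow> bool"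
  for G X where
  refl: "p \<in> cayley G X \<Longrightarrow> cayley_path G X p 0 p"
| step: "\<lbrakk>cayley_path G X p l (edge_point g (g \<otimes>\<^bsub>G\<^esub> x) s);
          g \<in> carrier G; x \<in> sym_gens G X; s \<in> {0..1}; t \<in> {0..1}\<rbrakk>
         \<Longrightarrow> cayley_path G X p (l + \<bar>s - t\<bar>) (edge_point g (g \<otimes>\<^bsub>G\<^esub> x) t)"

definition cayley_dist :: "('a, 'b) monoid_scheme \<Rightarrow> 'a set \<Rightarrow> 'a cpoint \<Rightarrow> 'a cpoint \<Rightarrow> real" where
  "cayley_dist G X p q = Inf {l. cayley_path G X p l q}"

definition closed_nbhd ::
  "('a, 'b) monoid_scheme \<Rightarrow> 'a set \<Rightarrow> real \<Rightarrow> 'a cpoint set \<Rightarrow> 'a cpoint set" where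
  "closed_nbhd G X r A = {p \<in> cayley G X. \<exists>q\<in>A. cayley_dist G X p q \<le> r}"

definition geodesic ::
  "('a, 'b) monoid_scheme \<Rightarrow> 'a set \<Rightarrow> 'a cpoint \<Rightarrow> 'a cpoint \<Rightarrow> 'a cpoint set \<Rightarrow> bool" where
  "geodesic G X p q S \<longleftrightarrow>
     (\<exists>l \<gamma>. 0 \<le> l \<and> \<gamma> ` {0..l} = S \<and> S \<subseteq> cayley G X \<and> \<gamma> 0 = p \<and> \<gamma> l = q \<and>
        (\<forall>s\<in>{0..l}. \<forall>t\<in>{0..l}. cayley_dist G X (\<gamma> s) (\<gamma> t) = \<bar>s - t\<bar>))"

definition geodesic_triangle ::
  "('a, 'b) monoid_scheme \<Rightarrow> 'a set \<Rightarrow> 'a cpoint set \<Rightarrow> 'a cpoint set \<Rightarrow> 'a cpoint set \<Rightarrow> bool" where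
  "geodesic_triangle G X A B C \<longleftrightarrow>
     (\<exists>p q r. geodesic G X p q A \<and> geodesic G X q r B \<and> geodesic G X r p C)"

definition negatively_curved :: "('a, 'b) monoid_scheme \<Rightarrow> 'a set \<Rightarrow> bool" where
  "negatively_curved G X \<longleftrightarrow>
     (\<exists>\<delta>\<ge>0. \<forall>A B C. geodesic_triangle G X A B C \<longrightarrow>
        A \<subseteq> closed_nbhd G X \<delta> (B \<union> C) \<and>
        B \<subseteq> closed_nbhd G X \<delta> (C \<union> A) \<and>
        C \<subseteq> closed_nbhd G X \<delta> (A \<union> B))"

definition quasiconvex :: "('a, 'b) monoid_scheme \<Rightarrow> 'a set \<Rightarrow> 'a set \<Rightarrow> bool" where
  "quasiconvex G X H \<longleftrightarrow>
     (\<exists>K\<ge>0. \<forall>h\<in>H. \<forall>h'\<in>H. \<forall>S. geodesic G X (vertex h) (vertex h') S \<longrightarrow>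
        S \<subseteq> closed_nbhd G X K (vertex ` H))"

definition double_coset :: "('a, 'b) monoid_scheme \<Rightarrow> 'a set \<Rightarrow> 'a \<Rightarrow> 'a set" where
  "double_coset G H g = (H #>\<^bsub>G\<^esub> g) <#>\<^bsub>G\<^esub> H"

definition weak_width_witness ::
  "'a set \<Rightarrow> ('a, 'b) monoid_scheme \<Rightarrow> nat \<Rightarrow> (nat \<Rightarrow> 'a) \<Rightarrow> bool" where
  "weak_width_witness H G n g \<longleftrightarrow>
     n \<ge> 1 \<and> g 1 = \<one>\<^bsub>G\<^esub> \<and> (\<forall>i\<in>{1..n}. g i \<in> carrier G) \<and>
     (\<forall>i\<in>{1..n}. \<forall>j\<in>{1..n}. i \<noteq> j \<longrightarrow> double_coset G H (g i) \<noteq> double_coset G H (g j)) \<and>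
     (\<forall>i\<in>{1..n}. infinite (H \<inter> ((inv\<^bsub>G\<^esub> (g i) <#\<^bsub>G\<^esub> H) #>\<^bsub>G\<^esub> g i)))"

text \<open>In \<^typ>\<open>enat\<close> the supremum of a nonempty set is its maximum, or \<open>\<infinity>\<close> if there is none.\<close>

definition weak_width :: "'a set \<Rightarrow> ('a, 'b) monoid_scheme \<Rightarrow> enat" where
  "weak_width H G = (if finite H then 0 else SUP n \<in> {n. \<exists>g. weak_width_witness H G n g}. enat n)"

end

theory Submission imports Defs begin

text \<open>Let triangles be \<open>\<delta>\<close>-slim and let \<open>H\<close> be
  \<open>K\<close>-quasiconvex. If \<open>g\<close> has an infinite intersection of \<open>H\<close>
  with its conjugate by \<open>g\<close>, then the double coset of \<open>g\<close> contains an
  element of word length at most \<open>2 * K + 2 * \<delta>\<close>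
  (\<open>double_coset_short_rep\<close>, \<open>double_coset_eq\<close>). Balls in the word length
  are finite because \<open>X\<close> is, so only finitely many double cosets can occur in a
  witness, and their number bounds the weak width.

  For the short representative, join closest points \<open>h1\<close> of \<open>H\<close> and
  \<open>g h2\<close> of \<open>gH\<close>. The elements \<open>h' = g h g^-1\<close> of
  \<open>H\<close> coming from the intersection preserve both \<open>H\<close> and
  \<open>gH\<close>, and as there are infinitely many of them, some \<open>h'\<close> moves
  \<open>h1\<close> very far. In the quadrilateral with corners \<open>h1\<close>,
  \<open>g h2\<close>, \<open>h' g h2\<close>, \<open>h' h1\<close> the midpoint of the long side
  along \<open>H\<close> lies near another side (\<open>slim_quadrilateral\<close>). It cannot be
  near the two sides joining \<open>H\<close> to \<open>gH\<close>: these are shortest connections,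
  and leave \<open>H\<close> near their ends (\<open>geodesic_near_start\<close>). So it is near the
  side along \<open>gH\<close>, which by quasiconvexity stays close to \<open>gH\<close>
  (\<open>quasiconvex_const_coset\<close>). Hence \<open>H\<close> and \<open>gH\<close> are close,
  which is the claim.

  The groundwork on the Cayley graph supplies what this uses: left translations are isometries
  (\<open>dist_translate\<close>), vertices are joined by geodesics, and their distance is a word
  length (\<open>geodesic_of_word\<close>).\<close>

lemma edge_point_0 [simp]: "edge_point a b 0 = vertex a"
  and edge_point_1 [simp]: "edge_point a b 1 = vertex b"
  by (auto simp: edge_point_def)

section \<open>Affine extension of functions on the vertices\<close>

text \<open>Points are barycentric coordinates, so the weighted sum over the support is affine along
  every edge. It serves to bound distances from below, by extending a word length from the vertices
  to the graph.\<close>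

definition linear_ext :: "('a \<Rightarrow> real) \<Rightarrow> 'a cpoint \<Rightarrow> real" where
  "linear_ext f p = (\<Sum>w | p w \<noteq> 0. p w * f w)"

lemma linear_ext_edge_point:
  "linear_ext f (edge_point a b t) = (1 - t) * f a + t * f b"
proof -
  have "linear_ext f (edge_point a b t) = (\<Sum>w\<in>{a, b}. edge_point a b t w * f w)"
    unfolding linear_ext_def
    by (rule sum.mono_neutral_left) (auto simp: edge_point_def vertex_def of_bool_def split: if_splits)
  also have "\<dots> = (1 - t) * f a + t * f b"
    by (cases "a = b") (auto simp: edge_point_def vertex_def algebra_simps)
  finally show ?thesis .
qed

lemma linear_ext_vertex [simp]: "linear_ext f (vertex a) = f a"
  using linear_ext_edge_point[of f a a 0] by simp

lemma cayley_dist_le: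
  assumes "cayley_path G X p l q" shows "cayley_dist G X p q \<le> l"
proof -
  \<comment> \<open>A real \<open>Inf\<close> is a lower bound only for sets that are bounded
    below.\<close>
  have "0 \<le> l" if "cayley_path G X p l q" for l
    using that by induction auto
  then show ?thesis
    unfolding cayley_dist_def using assms by (intro cInf_lower bdd_belowI[of _ 0]) auto
qed

locale generated_group = group G for G (structure) +
  fixes X :: "'a set"
  assumes gens_closed: "X \<subseteq> carrier G" and generates: "generate G X = carrier G"
begin

abbreviation "cdist \<equiv> cayley_dist G X"

subsection \<open>Word length\<close>

lemma sym_gens_closed: "x \<in> sym_gens G X \<Longrightarrow> x \<in> carrier G"
  using gens_closed by (auto simp: sym_gens_def)

lemma inv_sym_gens: "x \<in> sym_gens G X \<Longrightarrow> inv x \<in> sym_gens G X"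
  using gens_closed by (auto simp: sym_gens_def)

text \<open>Exactly \<open>n\<close> letters, appended on the right, so that spelling a word is
  walking along Cayley edges; a ball is then a union over \<open>k \<le> n\<close>.\<close>

fun words :: "nat \<Rightarrow> 'a set" where
  "words 0 = {\<one>}"
| "words (Suc n) = (\<lambda>(g, x). g \<otimes> x) ` (words n \<times> sym_gens G X)"

lemma words_closed: "g \<in> words n \<Longrightarrow> g \<in> carrier G"
  by (induction n arbitrary: g) (auto simp: sym_gens_closed)

lemma finite_words: "finite X \<Longrightarrow> finite (words n)"
  by (induction n) (auto simp: sym_gens_def)

lemma words_mult:
  assumes "g \<in> words m" "h \<in> words n" shows "g \<otimes> h \<in> words (m + n)"
  using assms(2)
proof (induction n arbitrary: h)
  case 0
  then show ?case using assms(1) words_closed by simp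
next
  case (Suc n)
  then obtain h' x where h: "h' \<in> words n" "x \<in> sym_gens G X" "h = h' \<otimes> x" by auto
  then have "g \<otimes> h = (g \<otimes> h') \<otimes> x"
    using assms(1) words_closed sym_gens_closed by (simp add: m_assoc)
  then show ?case using h Suc.IH[OF h(1)] by force
qed

lemma sym_gens_words: "x \<in> sym_gens G X \<Longrightarrow> x \<in> words 1"
  using sym_gens_closed by force

lemma ex_words:
  assumes "g \<in> carrier G" shows "\<exists>n. g \<in> words n"
proof -
  have "g \<in> generate G X" using assms generates by simp
  then show ?thesis
  proof induction
    case one
    show ?case by (rule exI[of _ 0]) simp
  next
    case (incl h)
    then have "h \<in> sym_gens G X" by (simp add: sym_gens_def)
    then show ?case using sym_gens_words by blast
  next
    case (inv h)
    then have "inv h \<in> sym_gens G X" by (simp add: sym_gens_def)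
    then show ?case using sym_gens_words by blast
  next
    case (eng h1 h2)
    then show ?case using words_mult by blast
  qed
qed

definition word_len :: "'a \<Rightarrow> nat" where
  "word_len g = (LEAST n. g \<in> words n)"

lemma word_len_words: "g \<in> carrier G \<Longrightarrow> g \<in> words (word_len g)"
  unfolding word_len_def using ex_words by (auto intro: LeastI_ex)

lemma word_len_le: "g \<in> words n \<Longrightarrow> word_len g \<le> n"
  unfolding word_len_def by (rule Least_le)

lemma word_len_one [simp]: "word_len \<one> = 0"
  using word_len_le[of \<one> 0] by simp

lemma finite_word_len_le:
  assumes "finite X" shows "finite {g \<in> carrier G. word_len g \<le> n}"
proof (rule finite_subset)
  show "{g \<in> carrier G. word_len g \<le> n} \<subseteq> (\<Union>k\<le>n. words k)"
    using word_len_words by blast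
qed (simp add: finite_words assms)

text \<open>One more letter costs at most 1, and multiplying by \<open>inv x\<close> returns to
  \<open>g\<close>, which gives the other direction.\<close>

lemma word_len_mult_gen:
  assumes "g \<in> carrier G" "x \<in> sym_gens G X"
  shows "\<bar>real (word_len (g \<otimes> x)) - real (word_len g)\<bar> \<le> 1"
proof -
  have *: "word_len (a \<otimes> y) \<le> word_len a + 1" if "a \<in> carrier G" "y \<in> sym_gens G X" for a y
    using words_mult[OF word_len_words[OF that(1)] sym_gens_words[OF that(2)]] word_len_le by simp
  have "word_len ((g \<otimes> x) \<otimes> inv x) \<le> word_len (g \<otimes> x) + 1"
    using assms sym_gens_closed inv_sym_gens by (intro *) auto
  moreover have "(g \<otimes> x) \<otimes> inv x = g"
    using assms sym_gens_closed by (simp add: m_assoc)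
  ultimately show ?thesis using *[OF assms] by simp
qed

subsection \<open>The path metric\<close>

lemma cayley_cases:
  assumes "p \<in> cayley G X"
  obtains a b t where "a \<in> carrier G" "b \<in> carrier G" "p = edge_point a b t"
proof -
  have "\<exists>a b t. a \<in> carrier G \<and> b \<in> carrier G \<and> p = edge_point a b t"
    using assms unfolding cayley_def
  proof
    assume "p \<in> vertex ` carrier G"
    then obtain a where "a \<in> carrier G" "p = edge_point a a 0" by auto
    then show ?thesis by blast
  qed (use sym_gens_closed in blast)
  then show ?thesis using that by blast
qed

lemma vertex_in_cayley: "a \<in> carrier G \<Longrightarrow> vertex a \<in> cayley G X"
  by (simp add: cayley_def)

lemma edge_in_cayley:
  "\<lbrakk>a \<in> carrier G; x \<in> sym_gens G X; t \<in> {0..1}\<rbrakk> \<Longrightarrow> edge_point a (a \<otimes> x) t \<in> cayley G X"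
  unfolding cayley_def by blast

lemma path_edge:
  assumes "a \<in> carrier G" "x \<in> sym_gens G X" "s \<in> {0..1}" "t \<in> {0..1}"
  shows "cayley_path G X (edge_point a (a \<otimes> x) s) \<bar>s - t\<bar> (edge_point a (a \<otimes> x) t)"
  using cayley_path.step[OF cayley_path.refl[OF edge_in_cayley] assms] assms by simp

lemma path_trans:
  assumes "cayley_path G X p l q" "cayley_path G X q m r"
  shows "cayley_path G X p (l + m) r"
  using assms(2,1)
proof induction
  case (step q m a x s t)
  then show ?case using cayley_path.step[of G X p "l + m" a x s t] by (simp add: add.assoc)
qed simp

lemma path_sym: "cayley_path G X p l q \<Longrightarrow> cayley_path G X q l p"
proof (induction rule: cayley_path.induct)
  case (step p l a x s t)
  then show ?case
    using path_trans[OF path_edge[of a x t s]] by (simp add: add.commute abs_minus_commute)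
qed (rule cayley_path.refl)

lemma path_in_cayley:
  assumes "cayley_path G X p l q" shows "q \<in> cayley G X"
  using assms by cases (auto intro: edge_in_cayley)

lemma path_words:
  assumes "a \<in> carrier G" "g \<in> words n"
  shows "\<exists>l. cayley_path G X (vertex a) l (vertex (a \<otimes> g))"
  using assms(2)
proof (induction n arbitrary: g)
  case 0
  then show ?case using assms(1) cayley_path.refl vertex_in_cayley by force
next
  case (Suc n)
  then obtain g' x where g: "g' \<in> words n" "x \<in> sym_gens G X" "g = g' \<otimes> x" by auto
  then obtain l where l: "cayley_path G X (vertex a) l (vertex (a \<otimes> g'))" using Suc.IH by blast
  have "a \<otimes> g = a \<otimes> g' \<otimes> x"
    using g assms(1) words_closed sym_gens_closed by (simp add: m_assoc)
  then show ?case
    using path_trans[OF l] path_edge[of "a \<otimes> g'" x 0 1] g assms(1) words_closed by force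
qed

lemma path_from_vertex:
  assumes "p \<in> cayley G X" "a \<in> carrier G" shows "\<exists>l. cayley_path G X (vertex a) l p"
proof -
  have vertices: "\<exists>l. cayley_path G X (vertex a) l (vertex b)" if "b \<in> carrier G" for b
    using path_words[of a "inv a \<otimes> b"] word_len_words[of "inv a \<otimes> b"] assms(2) that
    by (auto simp flip: m_assoc)
  show ?thesis using assms(1) unfolding cayley_def
  proof
    assume "p \<in> vertex ` carrier G"
    then show ?thesis using vertices by auto
  next
    assume "p \<in> {edge_point g (g \<otimes> x) t |g x t. g \<in> carrier G \<and> x \<in> sym_gens G X \<and> t \<in> {0..1}}"
    then obtain b x t where b: "b \<in> carrier G" "x \<in> sym_gens G X" "t \<in> {0..1}"
      and p: "p = edge_point b (b \<otimes> x) t" by blast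
    obtain l where "cayley_path G X (vertex a) l (vertex b)" using vertices b by blast
    then show ?thesis using path_trans path_edge[of b x 0 t] b p by fastforce
  qed
qed

lemma path_connected:
  assumes "p \<in> cayley G X" "q \<in> cayley G X" shows "\<exists>l. cayley_path G X p l q"
  using path_from_vertex[OF _ one_closed] path_sym path_trans assms by meson

text \<open>Replaces attainment of the infimum by approximation. Connectedness makes the set of
  lengths nonempty, without which \<open>Inf\<close> would carry no information.\<close>

lemma dist_less_path:
  assumes "p \<in> cayley G X" "q \<in> cayley G X" "cdist p q < r"
  obtains l where "cayley_path G X p l q" "l < r"
  using cInf_lessD[of "{l. cayley_path G X p l q}" r] path_connected[OF assms(1,2)] assms(3)
  unfolding cayley_dist_def by blast

lemma dist_sym: "cdist p q = cdist q p"
  unfolding cayley_dist_def using path_sym by metis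

lemma dist_triangle:
  assumes "p \<in> cayley G X" "q \<in> cayley G X" "r \<in> cayley G X"
  shows "cdist p r \<le> cdist p q + cdist q r"
proof (rule field_le_epsilon)
  fix e :: real assume "e > 0"
  then obtain l m where "cayley_path G X p l q" "l < cdist p q + e / 2"
    "cayley_path G X q m r" "m < cdist q r + e / 2"
    using dist_less_path[of p q "cdist p q + e / 2"] dist_less_path[of q r "cdist q r + e / 2"] assms
    by (metis half_gt_zero less_add_same_cancel1)
  then show "cdist p r \<le> cdist p q + cdist q r + e"
    using cayley_dist_le[OF path_trans] by fastforce
qed

text \<open>Being affine of slope at most 1 on each edge, the linear extension of a 1-Lipschitz function
  on the vertices is 1-Lipschitz for the path metric.\<close>

lemma linear_ext_lipschitz:
  assumes f: "\<And>a x. \<lbrakk>a \<in> carrier G; x \<in> sym_gens G X\<rbrakk> \<Longrightarrow> \<bar>f (a \<otimes> x) - f a\<bar> \<le> 1"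
    and "p \<in> cayley G X" "q \<in> cayley G X"
  shows "\<bar>linear_ext f p - linear_ext f q\<bar> \<le> cdist p q"
proof -
  have "\<bar>linear_ext f p - linear_ext f q\<bar> \<le> l" if "cayley_path G X p l q" for l
    using that
  proof induction
    case (step p l a x s t)
    have "linear_ext f (edge_point a (a \<otimes> x) s) - linear_ext f (edge_point a (a \<otimes> x) t)
        = (s - t) * (f (a \<otimes> x) - f a)"
      by (simp add: linear_ext_edge_point algebra_simps)
    also have "\<bar>\<dots>\<bar> \<le> \<bar>s - t\<bar> * 1"
      unfolding abs_mult using f[OF step(2,3)] by (intro mult_left_mono) auto
    finally show ?case using step.IH by (smt (verit))
  qed simp
  then show ?thesis
    unfolding cayley_dist_def using path_connected[OF assms(2,3)] by (intro cInf_greatest) auto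
qed

subsection \<open>Left translations\<close>

text \<open>Left multiplication acts on coordinates by precomposition with \<open>inv g\<close>.
  Indicators of group elements vanish off the carrier, so with the value 0 there edge points go to
  edge points.\<close>

definition translate :: "'a \<Rightarrow> 'a cpoint \<Rightarrow> 'a cpoint" where
  "translate g p = (\<lambda>w. if w \<in> carrier G then p (inv g \<otimes> w) else 0)"

lemma translate_edge_point:
  assumes "g \<in> carrier G" "a \<in> carrier G" "b \<in> carrier G"
  shows "translate g (edge_point a b t) = edge_point (g \<otimes> a) (g \<otimes> b) t"
proof -
  have "inv g \<otimes> w = c \<longleftrightarrow> w = g \<otimes> c" if "w \<in> carrier G" "c \<in> carrier G" for w c
    using that assms(1) inv_solve_left[of c g w] by metis
  then show ?thesis using assms by (auto simp: translate_def edge_point_def vertex_def fun_eq_iff)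
qed

lemma translate_vertex:
  "\<lbrakk>g \<in> carrier G; a \<in> carrier G\<rbrakk> \<Longrightarrow> translate g (vertex a) = vertex (g \<otimes> a)"
  using translate_edge_point[of g a a 0] by simp

lemma translate_in_cayley:
  assumes "g \<in> carrier G" "p \<in> cayley G X" shows "translate g p \<in> cayley G X"
  using assms(2) unfolding cayley_def
proof
  assume "p \<in> vertex ` carrier G"
  then show "translate g p \<in> vertex ` carrier G \<union>
      {edge_point g (g \<otimes> x) t |g x t. g \<in> carrier G \<and> x \<in> sym_gens G X \<and> t \<in> {0..1}}"
    using assms(1) by (auto simp: translate_vertex)
next
  assume "p \<in> {edge_point g (g \<otimes> x) t |g x t. g \<in> carrier G \<and> x \<in> sym_gens G X \<and> t \<in> {0..1}}"
  then obtain a x t where a: "a \<in> carrier G" "x \<in> sym_gens G X" "t \<in> {0..1}"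
      and p: "p = edge_point a (a \<otimes> x) t" by blast
  then have "translate g p = edge_point (g \<otimes> a) (g \<otimes> a \<otimes> x) t"
    using assms(1) sym_gens_closed by (simp add: translate_edge_point m_assoc)
  then show "translate g p \<in> vertex ` carrier G \<union>
      {edge_point g (g \<otimes> x) t |g x t. g \<in> carrier G \<and> x \<in> sym_gens G X \<and> t \<in> {0..1}}"
    using a assms(1) by blast
qed

lemma translate_inv_cancel:
  assumes "g \<in> carrier G" "p \<in> cayley G X" shows "translate (inv g) (translate g p) = p"
  using assms(2)
proof (rule cayley_cases)
  fix a b t assume "a \<in> carrier G" "b \<in> carrier G" "p = edge_point a b t"
  then show ?thesis using assms(1) by (simp add: translate_edge_point flip: m_assoc)
qed

lemma translate_path:
  assumes "g \<in> carrier G" "cayley_path G X p l q"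
  shows "cayley_path G X (translate g p) l (translate g q)"
  using assms(2)
proof induction
  case (refl p)
  then show ?case using translate_in_cayley assms(1) by (blast intro: cayley_path.refl)
next
  case (step p l a x s t)
  have *: "translate g (edge_point a (a \<otimes> x) u) = edge_point (g \<otimes> a) (g \<otimes> a \<otimes> x) u" for u
    using step assms(1) sym_gens_closed by (simp add: translate_edge_point m_assoc)
  show ?case unfolding *
    using step assms(1) by (intro cayley_path.step) (auto simp: *)
qed

text \<open>Translating by \<open>g\<close> and back by \<open>inv g\<close> shows that both pairs
  of points are joined by paths of the same lengths.\<close>

lemma dist_translate:
  assumes "g \<in> carrier G" "p \<in> cayley G X" "q \<in> cayley G X"
  shows "cdist (translate g p) (translate g q) = cdist p q"
proof -
  have "cayley_path G X (translate g p) l (translate g q) = cayley_path G X p l q" for l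
    using translate_path[OF assms(1)] translate_path[OF inv_closed[OF assms(1)]]
      translate_inv_cancel[OF assms(1)] assms(2,3) by metis
  then show ?thesis by (simp add: cayley_dist_def)
qed

lemma geodesic_translate:
  assumes "g \<in> carrier G" "geodesic G X p q S"
  shows "geodesic G X (translate g p) (translate g q) (translate g ` S)"
proof -
  obtain l \<gamma> where \<gamma>: "0 \<le> l" "\<gamma> ` {0..l} = S" "S \<subseteq> cayley G X" "\<gamma> 0 = p" "\<gamma> l = q"
    "\<forall>s\<in>{0..l}. \<forall>t\<in>{0..l}. cdist (\<gamma> s) (\<gamma> t) = \<bar>s - t\<bar>"
    using assms(2) unfolding geodesic_def by blast
  have "\<gamma> s \<in> cayley G X" if "s \<in> {0..l}" for s using \<gamma>(2,3) that by blast
  then show ?thesis unfolding geodesic_def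
    using \<gamma> assms(1) translate_in_cayley
    by (intro exI[of _ l] exI[of _ "translate g \<circ> \<gamma>"]) (auto simp: dist_translate)
qed

subsection \<open>Geodesics\<close>

lemma geodesic_flip:
  assumes "geodesic G X p q S" shows "geodesic G X q p S"
proof -
  obtain l \<gamma> where \<gamma>: "0 \<le> l" "\<gamma> ` {0..l} = S" "S \<subseteq> cayley G X" "\<gamma> 0 = p" "\<gamma> l = q"
    "\<forall>s\<in>{0..l}. \<forall>t\<in>{0..l}. cdist (\<gamma> s) (\<gamma> t) = \<bar>s - t\<bar>"
    using assms unfolding geodesic_def by blast
  have "(\<lambda>t. l - t) ` {0..l} = {0..l}" by simp
  then have "(\<lambda>t. \<gamma> (l - t)) ` {0..l} = S" using \<gamma>(2) by (metis image_image)
  then show ?thesis unfolding geodesic_def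
    using \<gamma> by (intro exI[of _ l] exI[of _ "\<lambda>t. \<gamma> (l - t)"]) (auto simp: abs_minus_commute)
qed

lemma geodesic_dist:
  assumes "geodesic G X p q S" "z \<in> S"
  shows "z \<in> cayley G X" "cdist p q = cdist p z + cdist z q"
  using assms unfolding geodesic_def by force+

lemma geodesic_midpoint:
  assumes "geodesic G X p q S"
  obtains z where "z \<in> S" "cdist p z = cdist p q / 2" "cdist z q = cdist p q / 2"
proof -
  obtain l \<gamma> where \<gamma>: "0 \<le> l" "\<gamma> ` {0..l} = S" "\<gamma> 0 = p" "\<gamma> l = q"
    "\<forall>s\<in>{0..l}. \<forall>t\<in>{0..l}. cdist (\<gamma> s) (\<gamma> t) = \<bar>s - t\<bar>"
    using assms unfolding geodesic_def by blast
  have "cdist p q = l" "cdist p (\<gamma> (l/2)) = l/2" "cdist (\<gamma> (l/2)) q = l/2" "\<gamma> (l/2) \<in> S"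
    using \<gamma>(1) \<gamma>(5)[rule_format, of 0 l] \<gamma>(5)[rule_format, of 0 "l/2"]
      \<gamma>(5)[rule_format, of "l/2" l] \<gamma>(2-4) by auto
  then show ?thesis using that by simp
qed

section \<open>Geodesics spelled by shortest words\<close>

lemma words_vertex_sequence:
  assumes "a \<in> carrier G" "g \<in> words n"
  shows "\<exists>v. v 0 = a \<and> v n = a \<otimes> g \<and> (\<forall>i. v i \<in> carrier G) \<and>
    (\<forall>i<n. \<exists>x\<in>sym_gens G X. v (Suc i) = v i \<otimes> x)"
  using assms(2)
proof (induction n arbitrary: g)
  case 0
  then show ?case using assms(1) by (intro exI[of _ "\<lambda>_. a"]) simp
next
  case (Suc n)
  then obtain g' x where g: "g' \<in> words n" "x \<in> sym_gens G X" "g = g' \<otimes> x" by auto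
  then obtain v where v: "v 0 = a" "v n = a \<otimes> g'" "\<forall>i. v i \<in> carrier G"
    "\<forall>i<n. \<exists>x\<in>sym_gens G X. v (Suc i) = v i \<otimes> x" using Suc.IH by blast
  have eq: "a \<otimes> g = v n \<otimes> x"
    using g v(2) assms(1) words_closed sym_gens_closed by (simp add: m_assoc)
  define v' where "v' = v(Suc n := a \<otimes> g)"
  have "a \<otimes> g \<in> carrier G" using Suc.prems assms(1) words_closed by blast
  then have "v' 0 = a" "v' (Suc n) = a \<otimes> g" "\<forall>i. v' i \<in> carrier G"
    using v(1,3) by (simp_all add: v'_def)
  moreover have "\<exists>x\<in>sym_gens G X. v' (Suc i) = v' i \<otimes> x" if "i < Suc n" for i
  proof (cases "i = n")
    case True
    then show ?thesis using eq g(2) by (auto simp: v'_def)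
  next
    case False
    then show ?thesis using v(4) that by (simp add: v'_def)
  qed
  ultimately show ?case by blast
qed

text \<open>A shortest word for \<open>inv a \<otimes> b\<close> is traversed at unit speed. The
  path itself bounds distances from above; from below they are bounded by the 1-Lipschitz extension
  of the word length measured from \<open>a\<close>, which takes the value \<open>t\<close> at time
  \<open>t\<close>.\<close>

lemma geodesic_of_word:
  assumes a: "a \<in> carrier G" and b: "b \<in> carrier G"
  shows "\<exists>S. geodesic G X (vertex a) (vertex b) S"
    and "cdist (vertex a) (vertex b) = word_len (inv a \<otimes> b)"
proof -
  define n where "n = word_len (inv a \<otimes> b)"
  define f where "f c = real (word_len (inv a \<otimes> c))" for c
  have "inv a \<otimes> b \<in> words n" unfolding n_def using a b by (intro word_len_words) simp
  moreover have "a \<otimes> (inv a \<otimes> b) = b" using a b by (simp flip: m_assoc)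
  ultimately obtain v where v: "v 0 = a" "v n = b" "\<And>i. v i \<in> carrier G"
    and v_Suc: "\<And>i. i < n \<Longrightarrow> \<exists>x\<in>sym_gens G X. v (Suc i) = v i \<otimes> x"
    using words_vertex_sequence[OF a, of "inv a \<otimes> b" n] by auto
  have f_lip: "\<bar>f (c \<otimes> x) - f c\<bar> \<le> 1" if "c \<in> carrier G" "x \<in> sym_gens G X" for c x
    using word_len_mult_gen[of "inv a \<otimes> c" x] that a sym_gens_closed by (simp add: f_def m_assoc)
  have f_Suc: "\<bar>f (v (Suc i)) - f (v i)\<bar> \<le> 1" if "i < n" for i
    using v_Suc[OF that] f_lip v(3) by auto
  \<comment> \<open>\<open>f\<close> goes from 0 to \<open>n\<close> in \<open>n\<close> steps of
    size at most 1, so each step must gain exactly 1: \<open>up\<close> counts from the start,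
    \<open>down\<close> back from the end.\<close>
  have up: "f (v i) \<le> i" if "i \<le> n" for i
    using that
  proof (induction i)
    case (Suc i)
    then show ?case using f_Suc[of i] by simp
  qed (use v a in \<open>simp add: f_def\<close>)
  have down: "f (v i) \<ge> i" if "i \<le> n" for i
    using that
  proof (induction rule: inc_induct)
    case (step i)
    then show ?case using f_Suc[of i] by simp
  qed (use v in \<open>simp add: f_def n_def\<close>)
  \<comment> \<open>At \<open>t = n\<close> the pair \<open>v n\<close>, \<open>v (Suc n)\<close>
    need not be an edge, but the parameter is then 0 and the point is
    \<open>vertex (v n)\<close>.\<close>
  define \<gamma> where "\<gamma> t = edge_point (v (nat \<lfloor>t\<rfloor>)) (v (Suc (nat \<lfloor>t\<rfloor>))) (t - nat \<lfloor>t\<rfloor>)" for t :: real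
  have \<gamma>_nat: "\<gamma> (real i) = vertex (v i)" for i by (simp add: \<gamma>_def)
  have \<gamma>_edge: "\<gamma> t = edge_point (v i) (v (Suc i)) (t - i)" if "real i \<le> t" "t \<le> i + 1" for i t
  proof (cases "t = i + 1")
    case True
    then show ?thesis using \<gamma>_nat[of "Suc i"] by (simp add: add.commute)
  next
    case False
    then have "\<lfloor>t\<rfloor> = int i" using that by (intro floor_unique) auto
    then show ?thesis by (simp add: \<gamma>_def)
  qed
  have step: "cayley_path G X (\<gamma> s) (t - s) (\<gamma> t)"
    if "i < n" "real i \<le> s" "s \<le> t" "t \<le> i + 1" for i s t
  proof -
    obtain x where x: "x \<in> sym_gens G X" "v (Suc i) = v i \<otimes> x"
      using v_Suc \<open>i < n\<close> by blast
    have "\<bar>(s - i) - (t - i)\<bar> = t - s" using that by simp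
    then show ?thesis
      using path_edge[OF v(3) x(1), of "s - i" "t - i" i] \<gamma>_edge[of i s] \<gamma>_edge[of i t] x(2) that
      by simp
  qed
  have path: "cayley_path G X (\<gamma> s) (t - s) (\<gamma> t)" if "k \<le> n" "0 \<le> s" "s \<le> t" "t \<le> real k" for k s t
    using that
  proof (induction k arbitrary: s t)
    case 0
    then have "s = 0" "t = 0" by auto
    then show ?case
      using \<gamma>_nat[of 0] v(1) cayley_path.refl[OF vertex_in_cayley[OF a]] by simp
  next
    case (Suc k)
    consider "t \<le> k" | "s \<ge> k" | "s < k" "k < t" by linarith
    then show ?case
    proof cases
      case 1
      then show ?thesis using Suc by simp
    next
      case 2
      then show ?thesis using Suc.prems step[of k s t] by simp
    next
      case 3
      then show ?thesis
        using path_trans[OF Suc.IH[of s k] step[of k k t]] Suc.prems by simp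
    qed
  qed
  have in_cayley: "\<gamma> t \<in> cayley G X" if "t \<in> {0..real n}" for t
    using path[of n 0 t] path_in_cayley that by auto
  have F: "linear_ext f (\<gamma> t) = t" if t: "t \<in> {0..real n}" for t
  proof (cases "t = n")
    case True
    then show ?thesis using \<gamma>_nat[of n] v(2) by (simp add: f_def n_def)
  next
    case False
    define i where "i = nat \<lfloor>t\<rfloor>"
    have i: "real i \<le> t" "t < i + 1" "i < n" using t False unfolding i_def by (auto, linarith+)
    then have "f (v i) = i" "f (v (Suc i)) = Suc i"
      using up[of i] down[of i] up[of "Suc i"] down[of "Suc i"] by linarith+
    then show ?thesis using \<gamma>_edge[of i t] i by (simp add: linear_ext_edge_point algebra_simps)
  qed
  have le: "cdist (\<gamma> s) (\<gamma> t) = t - s" if "0 \<le> s" "s \<le> t" "t \<le> real n" for s t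
  proof (rule antisym)
    show "cdist (\<gamma> s) (\<gamma> t) \<le> t - s" using path[of n s t] that by (simp add: cayley_dist_le)
    show "t - s \<le> cdist (\<gamma> s) (\<gamma> t)"
      using linear_ext_lipschitz[of f "\<gamma> s" "\<gamma> t", OF f_lip] in_cayley F that by auto
  qed
  have dist_eq: "cdist (\<gamma> s) (\<gamma> t) = \<bar>s - t\<bar>" if "s \<in> {0..real n}" "t \<in> {0..real n}" for s t
    using le[of s t] le[of t s] dist_sym[of "\<gamma> s" "\<gamma> t"] that by (cases "s \<le> t") auto
  have ends: "\<gamma> 0 = vertex a" "\<gamma> (real n) = vertex b" using \<gamma>_nat[of 0] \<gamma>_nat[of n] v by auto
  then have "geodesic G X (vertex a) (vertex b) (\<gamma> ` {0..real n})"
    unfolding geodesic_def using in_cayley dist_eq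
    by (intro exI[of _ "real n"] exI[of _ \<gamma>]) auto
  then show "\<exists>S. geodesic G X (vertex a) (vertex b) S" by blast
  show "cdist (vertex a) (vertex b) = word_len (inv a \<otimes> b)"
    using dist_eq[of 0 "real n"] ends by (simp add: n_def)
qed

lemma dist_vertex_translate:
  assumes "g \<in> carrier G" "a \<in> carrier G" "b \<in> carrier G"
  shows "cdist (vertex (g \<otimes> a)) (vertex (g \<otimes> b)) = cdist (vertex a) (vertex b)"
  using dist_translate[of g "vertex a" "vertex b"] assms by (simp add: translate_vertex vertex_in_cayley)

subsection \<open>Hyperbolicity and quasiconvexity\<close>

text \<open>Fixes the constant for the estimates below. Relabelling a triangle cyclically brings any
  of its sides into the place of \<open>A\<close>.\<close>

definition slim_triangles :: "real \<Rightarrow> bool" where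
  "slim_triangles \<delta> \<longleftrightarrow> (\<forall>A B C. geodesic_triangle G X A B C \<longrightarrow> A \<subseteq> closed_nbhd G X \<delta> (B \<union> C))"

text \<open>The diagonal \<open>E\<close> cuts the quadrilateral into two triangles, and passing
  through each costs \<open>\<delta>\<close>.\<close>

lemma slim_quadrilateral:
  assumes slim: "slim_triangles \<delta>" and "0 \<le> \<delta>"
    and ad: "geodesic G X a d A" and ab: "geodesic G X a b B"
    and bc: "geodesic G X b c C" and dc: "geodesic G X d c D"
    and ac: "geodesic G X a c E"
    and m: "m \<in> A"
  shows "\<exists>q\<in>B \<union> C \<union> D. cdist m q \<le> 2 * \<delta>"
proof -
  have "geodesic_triangle G X A D E"
    unfolding geodesic_triangle_def using ad dc geodesic_flip[OF ac] by blast
  then obtain q where q: "q \<in> D \<union> E" "cdist m q \<le> \<delta>"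
    using slim m unfolding slim_triangles_def closed_nbhd_def by blast
  show ?thesis
  proof (cases "q \<in> D")
    case True
    then show ?thesis using q \<open>0 \<le> \<delta>\<close> by (intro bexI[of _ q]) auto
  next
    case False
    have "geodesic_triangle G X E C B"
      unfolding geodesic_triangle_def
      using ac geodesic_flip[OF bc] geodesic_flip[OF ab] by blast
    then obtain r where r: "r \<in> B \<union> C" "cdist q r \<le> \<delta>"
      using slim q(1) False unfolding slim_triangles_def closed_nbhd_def by blast
    have "cdist m r \<le> cdist m q + cdist q r"
      using dist_triangle geodesic_dist(1) m q(1) False r(1) ad ac ab bc by blast
    then show ?thesis using q r by (intro bexI[of _ r]) auto
  qed
qed

definition quasiconvex_const :: "real \<Rightarrow> 'a set \<Rightarrow> bool" where
  "quasiconvex_const K H \<longleftrightarrow> (\<forall>h\<in>H. \<forall>h'\<in>H. \<forall>S. geodesic G X (vertex h) (vertex h') S \<longrightarrow>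
     S \<subseteq> closed_nbhd G X K (vertex ` H))"

text \<open>Translation by \<open>inv g\<close> is an isometry that carries \<open>gH\<close> to
  \<open>H\<close>.\<close>

lemma quasiconvex_const_coset:
  assumes "quasiconvex_const K H" "H \<subseteq> carrier G" "g \<in> carrier G" "h \<in> H" "h' \<in> H"
    and S: "geodesic G X (vertex (g \<otimes> h)) (vertex (g \<otimes> h')) S" and q: "q \<in> S"
  shows "\<exists>k\<in>H. cdist q (vertex (g \<otimes> k)) \<le> K"
proof -
  have carr: "k \<in> carrier G" if "k \<in> H" for k using that assms(2) by blast
  have "translate (inv g) (vertex (g \<otimes> k)) = vertex k" if "k \<in> H" for k
    using translate_vertex[of "inv g" "g \<otimes> k"] carr[OF that] assms(3) by (simp flip: m_assoc)
  then have "geodesic G X (vertex h) (vertex h') (translate (inv g) ` S)"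
    using geodesic_translate[OF _ S, of "inv g"] assms by simp
  then obtain k where k: "k \<in> H" "cdist (translate (inv g) q) (vertex k) \<le> K"
    using assms(1,4,5) q unfolding quasiconvex_const_def closed_nbhd_def by blast
  have qc: "q \<in> cayley G X" using geodesic_dist(1)[OF S q] .
  have "cdist (translate g (translate (inv g) q)) (translate g (vertex k)) \<le> K"
    using k carr qc assms(3) by (simp add: dist_translate translate_in_cayley vertex_in_cayley)
  moreover have "translate g (translate (inv g) q) = q"
    using translate_inv_cancel[of "inv g" q] qc assms(3) by simp
  ultimately show ?thesis using k carr translate_vertex assms(3) by auto
qed

section \<open>Closest points and short double coset representatives\<close>

text \<open>Cancel \<open>cdist z q\<close> in \<open>cdist p z + cdist z q = cdist p q \<le> cdist
  x q \<le> cdist x z + cdist z q\<close>. It is applied with \<open>p\<close> a point of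
  \<open>H\<close> closest to \<open>q\<close> and \<open>x\<close> any other point of
  \<open>H\<close>.\<close>

lemma geodesic_near_start:
  assumes S: "geodesic G X p q S" and z: "z \<in> S" and "x \<in> cayley G X" "q \<in> cayley G X"
    and "cdist p q \<le> cdist x q" "cdist x z \<le> r"
  shows "cdist p z \<le> r"
  using geodesic_dist[OF S z] dist_triangle[of x z q] assms by linarith

text \<open>Let \<open>[h\<^sub>1, g h\<^sub>2]\<close> realise the distance from \<open>H\<close> to \<open>gH\<close> and let \<open>h' = g h g\<inverse>\<close>. Then
  \<open>[h' h\<^sub>1, h' g h\<^sub>2]\<close> realises it as well, so both sides leave the neighbourhood of \<open>H\<close> at once, and
  the midpoint of \<open>[h\<^sub>1, h' h\<^sub>1]\<close> can be close only to the remaining side, which stays near \<open>gH\<close>.\<close>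

lemma double_coset_short_rep:
  assumes slim: "slim_triangles \<delta>" "0 \<le> \<delta>" and qc: "quasiconvex_const K H"
    and "subgroup H G" "finite X" and g: "g \<in> carrier G"
    and inf: "infinite (H \<inter> ((inv g <# H) #> g))"
  shows "\<exists>h1\<in>H. \<exists>h2\<in>H. real (word_len (inv h1 \<otimes> (g \<otimes> h2))) \<le> 2 * K + 2 * \<delta>"
proof -
  interpret H: subgroup H G by fact
  define \<mu> where "\<mu> = (\<lambda>(h1, h2). word_len (inv h1 \<otimes> (g \<otimes> h2)))"
  obtain h1 h2 where h12: "h1 \<in> H" "h2 \<in> H"
    and min: "\<And>k1 k2. \<lbrakk>k1 \<in> H; k2 \<in> H\<rbrakk> \<Longrightarrow> \<mu> (h1, h2) \<le> \<mu> (k1, k2)"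
  proof -
    have "(\<one>, \<one>) \<in> H \<times> H" by simp
    from ex_has_least_nat[of "\<lambda>z. z \<in> H \<times> H", OF this, of \<mu>] show ?thesis using that by force
  qed
  have carr [simp]: "k \<in> H \<Longrightarrow> k \<in> carrier G" for k using H.subset by blast
  note [simp] = g
  have vdist: "cdist (vertex k1) (vertex (g \<otimes> k2)) = \<mu> (k1, k2)" if "k1 \<in> H" "k2 \<in> H" for k1 k2
    using geodesic_of_word(2)[of k1 "g \<otimes> k2"] that by (simp add: \<mu>_def)
  \<comment> \<open>Half of this length is \<open>4 * \<delta> + K\<close>: the
    \<open>K + 2 * \<delta>\<close> from an end of the long side to \<open>q\<close>, plus the
    \<open>2 * \<delta>\<close> from \<open>q\<close> to the midpoint.\<close>
  define N where "N = nat \<lceil>8 * \<delta> + 2 * K\<rceil>"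
  define J where "J = H \<inter> ((inv g <# H) #> g)"
  \<comment> \<open>The length of \<open>\<phi> h\<close> is the distance by which
    \<open>g \<otimes> h \<otimes> inv g\<close> moves \<open>h1\<close>; infinitely many values
    cannot fit into a finite ball.\<close>
  define \<phi> where "\<phi> h = inv h1 \<otimes> (g \<otimes> h \<otimes> inv g \<otimes> h1)" for h
  have "inj_on \<phi> J"
    unfolding \<phi>_def J_def using h12 by (intro inj_onI) (simp add: m_assoc)
  then have "infinite (\<phi> ` J)" using inf finite_imageD unfolding J_def by blast
  then have "\<not> \<phi> ` J \<subseteq> {k \<in> carrier G. word_len k \<le> N}"
    using finite_word_len_le[OF \<open>finite X\<close>] finite_subset by blast
  moreover have "\<phi> ` J \<subseteq> carrier G" unfolding \<phi>_def J_def using h12 by auto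
  ultimately obtain h where h: "h \<in> J" "\<not> word_len (\<phi> h) \<le> N" by blast
  define h' where "h' = g \<otimes> h \<otimes> inv g"
  have hH: "h \<in> H" using h J_def by simp
  obtain k where k: "k \<in> H" "h = inv g \<otimes> k \<otimes> g"
    using h(1) unfolding J_def l_coset_def r_coset_def by blast
  then have "h' = k"
    unfolding h'_def by (simp add: m_assoc) (simp flip: m_assoc)
  then have h'H: "h' \<in> H" using k by simp
  \<comment> \<open>The corner \<open>h' g h2\<close> lies in \<open>gH\<close> again, so the side
    \<open>C\<close> has both ends in this coset.\<close>
  have h'g: "h' \<otimes> (g \<otimes> h2) = g \<otimes> (h \<otimes> h2)"
    unfolding h'_def using hH h12 by (simp add: m_assoc) (simp flip: m_assoc)
  have long: "cdist (vertex h1) (vertex (h' \<otimes> h1)) > 8 * \<delta> + 2 * K"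
  proof -
    have "cdist (vertex h1) (vertex (h' \<otimes> h1)) = word_len (\<phi> h)"
      using geodesic_of_word(2)[of h1 "h' \<otimes> h1"] h12 h'H by (simp add: \<phi>_def h'_def)
    then show ?thesis using h(2) unfolding N_def by linarith
  qed
  obtain A B C D E where
    A: "geodesic G X (vertex h1) (vertex (h' \<otimes> h1)) A" and
    B: "geodesic G X (vertex h1) (vertex (g \<otimes> h2)) B" and
    C: "geodesic G X (vertex (g \<otimes> h2)) (vertex (g \<otimes> (h \<otimes> h2))) C" and
    D: "geodesic G X (vertex (h' \<otimes> h1)) (vertex (g \<otimes> (h \<otimes> h2))) D" and
    E: "geodesic G X (vertex h1) (vertex (g \<otimes> (h \<otimes> h2))) E"
    using geodesic_of_word(1)[of h1 "h' \<otimes> h1"] geodesic_of_word(1)[of h1 "g \<otimes> h2"]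
      geodesic_of_word(1)[of "g \<otimes> h2" "g \<otimes> (h \<otimes> h2)"]
      geodesic_of_word(1)[of "h' \<otimes> h1" "g \<otimes> (h \<otimes> h2)"]
      geodesic_of_word(1)[of h1 "g \<otimes> (h \<otimes> h2)"] h12 hH h'H by auto
  obtain m where m: "m \<in> A"
    "cdist (vertex h1) m = cdist (vertex h1) (vertex (h' \<otimes> h1)) / 2"
    "cdist m (vertex (h' \<otimes> h1)) = cdist (vertex h1) (vertex (h' \<otimes> h1)) / 2"
    using geodesic_midpoint[OF A] .
  have mc: "m \<in> cayley G X" using geodesic_dist(1)[OF A m(1)] .
  have "A \<subseteq> closed_nbhd G X K (vertex ` H)"
    using qc[unfolded quasiconvex_const_def, rule_format, OF h12(1) H.m_closed[OF h'H h12(1)] A] .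
  then obtain x where x: "x \<in> H" "cdist m (vertex x) \<le> K"
    using m(1) unfolding closed_nbhd_def by blast
  have xc: "vertex x \<in> cayley G X" using x vertex_in_cayley by simp
  obtain q where q: "q \<in> B \<union> C \<union> D" "cdist m q \<le> 2 * \<delta>"
    using slim_quadrilateral[OF slim A B C D E m(1)] by blast
  have qc': "q \<in> cayley G X" using q(1) geodesic_dist(1) B C D by blast
  have xq: "cdist (vertex x) q \<le> K + 2 * \<delta>"
    using dist_triangle[OF xc mc qc'] x(2) q(2) dist_sym[of m "vertex x"] by linarith
  \<comment> \<open>\<open>h1\<close> is as close to \<open>g h2\<close> as \<open>x\<close> is, so
    \<open>q\<close> would be within \<open>K + 2 * \<delta>\<close> of \<open>h1\<close>, and the
    midpoint within \<open>K + 4 * \<delta>\<close>.\<close>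
  have "q \<notin> B"
  proof
    assume "q \<in> B"
    then have "cdist (vertex h1) q \<le> K + 2 * \<delta>"
      using geodesic_near_start[OF B _ xc _ _ xq] vdist min x h12 by (simp add: vertex_in_cayley)
    then show False
      using dist_triangle[of "vertex h1" q m] qc' mc h12 q(2) m(2) long dist_sym[of m q]
      by (simp add: vertex_in_cayley)
  qed
  \<comment> \<open>\<open>D\<close> joins the images under \<open>h'\<close> of the ends of
    \<open>B\<close>, so it too has the minimal length, and the same argument applies at
    \<open>h' h1\<close>.\<close>
  moreover have "q \<notin> D"
  proof
    assume "q \<in> D"
    moreover have "cdist (vertex (h' \<otimes> h1)) (vertex (g \<otimes> (h \<otimes> h2))) = \<mu> (h1, h2)"
      using dist_vertex_translate[of h' h1 "g \<otimes> h2"] vdist h12 h'H h'g by simp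
    ultimately have "cdist (vertex (h' \<otimes> h1)) q \<le> K + 2 * \<delta>"
      using geodesic_near_start[OF D _ xc _ _ xq] vdist min x h12 hH by (simp add: vertex_in_cayley)
    then show False
      using dist_triangle[of m q "vertex (h' \<otimes> h1)"] qc' mc h12 h'H q(2) m(3) long
        dist_sym[of q "vertex (h' \<otimes> h1)"]
      by (simp add: vertex_in_cayley)
  qed
  ultimately have "q \<in> C" using q(1) by blast
  then obtain y where y: "y \<in> H" "cdist q (vertex (g \<otimes> y)) \<le> K"
    using quasiconvex_const_coset[OF qc H.subset g _ _ C] h12 hH by blast
  \<comment> \<open>The pair \<open>(x, y)\<close> gives the short representative:
    \<open>K + 2 * \<delta>\<close> from \<open>x\<close> to \<open>q\<close>, then \<open>K\<close>
    on to \<open>g y\<close>.\<close>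
  have "real (\<mu> (x, y)) \<le> cdist (vertex x) q + cdist q (vertex (g \<otimes> y))"
    using vdist[OF x(1) y(1)] dist_triangle[of "vertex x" q "vertex (g \<otimes> y)"] xc qc' y(1)
    by (simp add: vertex_in_cayley)
  then have "real (\<mu> (x, y)) \<le> 2 * K + 2 * \<delta>" using xq y(2) by linarith
  then show ?thesis using x(1) y(1) unfolding \<mu>_def by auto
qed

section \<open>Counting double cosets\<close>

text \<open>Multiplying by elements of \<open>H\<close> on both sides can only shrink the double
  coset, and it can be undone by their inverses, so both inclusions come from
  \<open>sub\<close>.\<close>

lemma double_coset_eq:
  assumes "subgroup H G" "g \<in> carrier G" "h1 \<in> H" "h2 \<in> H"
  shows "double_coset G H (inv h1 \<otimes> (g \<otimes> h2)) = double_coset G H g"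
proof -
  interpret H: subgroup H G by fact
  have carr [simp]: "k \<in> H \<Longrightarrow> k \<in> carrier G" for k using H.subset by blast
  have sub: "double_coset G H (a \<otimes> (c \<otimes> b)) \<subseteq> double_coset G H c"
    if "a \<in> H" "b \<in> H" "c \<in> carrier G" for a b c
  proof
    fix w assume "w \<in> double_coset G H (a \<otimes> (c \<otimes> b))"
    then obtain k l where "k \<in> H" "l \<in> H" "w = k \<otimes> (a \<otimes> (c \<otimes> b)) \<otimes> l"
      unfolding double_coset_def r_coset_def set_mult_def by blast
    then have "k \<otimes> a \<in> H" "b \<otimes> l \<in> H" "w = (k \<otimes> a) \<otimes> c \<otimes> (b \<otimes> l)"
      using that by (auto simp: m_assoc)
    then show "w \<in> double_coset G H c"
      unfolding double_coset_def r_coset_def set_mult_def by blast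
  qed
  have g_eq: "h1 \<otimes> ((inv h1 \<otimes> (g \<otimes> h2)) \<otimes> inv h2) = g"
    using assms by (simp add: m_assoc) (simp flip: m_assoc)
  show ?thesis
  proof (rule antisym)
    show "double_coset G H (inv h1 \<otimes> (g \<otimes> h2)) \<subseteq> double_coset G H g"
      using assms by (intro sub) auto
    show "double_coset G H g \<subseteq> double_coset G H (inv h1 \<otimes> (g \<otimes> h2))"
      using sub[of h1 "inv h2" "inv h1 \<otimes> (g \<otimes> h2)"] assms unfolding g_eq by simp
  qed
qed

end

theorem mainTheorem4:
  fixes G :: "('a, 'b) monoid_scheme" and X H :: "'a set"
  assumes "group G"
    and "finite X" and "X \<subseteq> carrier G" and "generate G X = carrier G"
    and "negatively_curved G X"
    and "subgroup H G" and "quasiconvex G X H"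
  shows "weak_width H G < \<infinity>"
proof -
  interpret generated_group G X
    using assms(1,3,4) by (intro generated_group.intro generated_group_axioms.intro)
  obtain \<delta> where \<delta>: "0 \<le> \<delta>" "slim_triangles \<delta>"
    using assms(5) unfolding negatively_curved_def slim_triangles_def by (elim exE conjE) simp
  obtain K where K: "quasiconvex_const K H"
    using assms(7) unfolding quasiconvex_def quasiconvex_const_def by (elim exE conjE)
  define \<D> where "\<D> = double_coset G H ` {g \<in> carrier G. word_len g \<le> nat \<lfloor>2 * K + 2 * \<delta>\<rfloor>}"
  have fin: "finite \<D>" unfolding \<D>_def using finite_word_len_le[OF assms(2)] by simp
  \<comment> \<open>The double cosets of a witness are distinct members of the finite set
    \<open>\<D>\<close>.\<close>
  have "n \<le> card \<D>" if "weak_width_witness H G n g" for n g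
  proof -
    have in_\<D>: "double_coset G H (g i) \<in> \<D>" if i: "i \<in> {1..n}" for i
    proof -
      have gi: "g i \<in> carrier G" "infinite (H \<inter> ((inv\<^bsub>G\<^esub> (g i) <#\<^bsub>G\<^esub> H) #>\<^bsub>G\<^esub> g i))"
        using \<open>weak_width_witness H G n g\<close> i unfolding weak_width_witness_def by auto
      obtain h1 h2 where h: "h1 \<in> H" "h2 \<in> H"
        "real (word_len (inv\<^bsub>G\<^esub> h1 \<otimes>\<^bsub>G\<^esub> (g i \<otimes>\<^bsub>G\<^esub> h2))) \<le> 2 * K + 2 * \<delta>"
        using double_coset_short_rep[OF \<delta>(2,1) K assms(6,2) gi] by blast
      then have "word_len (inv\<^bsub>G\<^esub> h1 \<otimes>\<^bsub>G\<^esub> (g i \<otimes>\<^bsub>G\<^esub> h2)) \<le> nat \<lfloor>2 * K + 2 * \<delta>\<rfloor>"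
        by linarith
      then show ?thesis
        unfolding \<D>_def using double_coset_eq[OF assms(6) gi(1) h(1,2)] gi(1) h(1,2)
          subgroup.mem_carrier[OF assms(6)]
        by (intro image_eqI[of _ _ "inv\<^bsub>G\<^esub> h1 \<otimes>\<^bsub>G\<^esub> (g i \<otimes>\<^bsub>G\<^esub> h2)"]) auto
    qed
    have inj: "inj_on (\<lambda>i. double_coset G H (g i)) {1..n}"
      using that unfolding weak_width_witness_def inj_on_def by blast
    show ?thesis
      using card_inj_on_le[OF inj _ fin] in_\<D> by (simp add: image_subset_iff)
  qed
  \<comment> \<open>For finite \<open>H\<close> the width is 0; otherwise \<open>card \<D>\<close>
    bounds every term of the supremum.\<close>
  then have "weak_width H G \<le> enat (card \<D>)"
    unfolding weak_width_def by (auto intro!: SUP_least)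
  also have "\<dots> < \<infinity>" by simp
  finally show ?thesis .
qed

end
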